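(* Let $P$ be the uniform distribution on the boundary of the equilateral triangle with vertices $(0,0)$, $(1,0)$, $(\frac12,\frac{\sqrt3}{2})$. Then the quantization dimension $D(P)$ of $P$ exists and equals $1$, the dimension of the boundary of the triangle; that is, $$\lim_{n\to\infty}\frac{2\log n}{-\log V_n(P)}=1.$$ Moreover, the (one-dimensional) quantization coefficient of $P$ exists as a finite positive number and equals $\frac34$; that is, $$\lim_{n\to\infty}n^2V_n(P)=\frac34.$$
   Context: The uniform distribution $P$ on the boundary $L$ of the triangle (the union of its three sides, of total length $3$) is the Borel probability measure on $\mathbb{R}^2$ supported on $L$ given by $dP=\frac13\,ds$, where $s$ is arc length along $L$. For a Borel probability measure $P$ on $\mathbb{R}^d$ (here $d=2$) with $\int\|x\|^2dP(x)<\infty$ and a nonempty finite set $\alpha\subset\mathbb{R}^d$, put $V(P;\alpha)=\int\min_{c\in\alpha}\|x-c\|^2\,dP(x)$, with $\|\cdot\|$ the Euclidean norm. The $n$th quantization error is $V_n(P)=\inf\{V(P;\alpha):\alpha\subset\mathbb{R}^d,\ 1\le\operatorname{card}(\alpha)\leq n\}$. The lower and upper quantization dimensions are the $\liminf$ and $\limsup$ as $n\to\infty$ of $\frac{2\log n}{-\log V_n(P)}$; if they are equal, the common value is the quantization dimension $D(P)$. For $s>0$ the $s$-dimensional lower and upper quantization coefficients are the $\liminf$ and $\limsup$ of $n^{2/s}V_n(P)$; if they are equal, the common value is the $s$-dimensional quantization coefficient (here $s=1$). *)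

theory Defs
  imports "HOL-Analysis.Analysis" "HOL-Probability.Probability"
begin

text \<open>The following notions are meant for Borel probability measures with finite second moment.
  Then the distortion integrand is integrable, so the Bochner integral below is the true integral;
  the infimum is over a set of nonnegative reals, which is nonempty for every positive \<open>n\<close>.\<close>

definition distortion :: "('a::euclidean_space) measure \<Rightarrow> 'a set \<Rightarrow> real" where
  "distortion P \<alpha> = (\<integral>x. (MIN c\<in>\<alpha>. (norm (x - c))\<^sup>2) \<partial>P)"

definition quantization_error :: "('a::euclidean_space) measure \<Rightarrow> nat \<Rightarrow> real" where
  "quantization_error P n =
     (INF \<alpha>\<in>{\<alpha>. finite \<alpha> \<and> 1 \<le> card \<alpha> \<and> card \<alpha> \<le> n}. distortion P \<alpha>)"

definition lower_quantization_dimension :: "('a::euclidean_space) measure \<Rightarrow> ereal" where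
  "lower_quantization_dimension P =
     liminf (\<lambda>n. ereal (2 * ln (real n) / - ln (quantization_error P n)))"

definition upper_quantization_dimension :: "('a::euclidean_space) measure \<Rightarrow> ereal" where
  "upper_quantization_dimension P =
     limsup (\<lambda>n. ereal (2 * ln (real n) / - ln (quantization_error P n)))"

definition has_quantization_dimension :: "('a::euclidean_space) measure \<Rightarrow> ereal \<Rightarrow> bool" where
  "has_quantization_dimension P D \<longleftrightarrow>
     lower_quantization_dimension P = D \<and> upper_quantization_dimension P = D"

definition lower_quantization_coefficient :: "real \<Rightarrow> ('a::euclidean_space) measure \<Rightarrow> ereal" where
  "lower_quantization_coefficient s P =
     liminf (\<lambda>n. ereal (real n powr (2 / s) * quantization_error P n))"

definition upper_quantization_coefficient :: "real \<Rightarrow> ('a::euclidean_space) measure \<Rightarrow> ereal" where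
  "upper_quantization_coefficient s P =
     limsup (\<lambda>n. ereal (real n powr (2 / s) * quantization_error P n))"

definition has_quantization_coefficient :: "real \<Rightarrow> ('a::euclidean_space) measure \<Rightarrow> ereal \<Rightarrow> bool"
  where
  "has_quantization_coefficient s P C \<longleftrightarrow>
     lower_quantization_coefficient s P = C \<and> upper_quantization_coefficient s P = C"

definition vertex_O :: "real^2" where "vertex_O = vector [0, 0]"
definition vertex_A :: "real^2" where "vertex_A = vector [1, 0]"
definition vertex_B :: "real^2" where "vertex_B = vector [1/2, sqrt 3 / 2]"

definition triangle_boundary :: "(real^2) set" where
  "triangle_boundary = closed_segment vertex_O vertex_A \<union> closed_segment vertex_A vertex_B
     \<union> closed_segment vertex_B vertex_O"

text \<open>Arc-length parametrization of the boundary on \<open>{0..3}\<close>: all sides have length 1, so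
  \<open>linepath\<close> runs through each of them with unit speed.\<close>

definition triangle_path :: "real \<Rightarrow> real^2" where
  "triangle_path t =
     (if t \<le> 1 then linepath vertex_O vertex_A t
      else if t \<le> 2 then linepath vertex_A vertex_B (t - 1)
      else linepath vertex_B vertex_O (t - 2))"

definition triangle_uniform :: "(real^2) measure" where
  "triangle_uniform = distr (uniform_measure lborel {0..3}) borel triangle_path"

lemma triangle_side_lengths:
  "dist vertex_O vertex_A = 1" "dist vertex_A vertex_B = 1" "dist vertex_B vertex_O = 1"
  by (simp_all add: dist_vec_def L2_set_def sum_2 vertex_O_def vertex_A_def vertex_B_def
      dist_real_def power_divide)

lemma dist_linepath: "dist (linepath a b s) (linepath a b t) = \<bar>s - t\<bar> * dist a b"
proof -
  have "linepath a b s - linepath a b t = (s - t) *\<^sub>R (b - a)"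
    by (simp add: linepath_def algebra_simps)
  then show ?thesis
    by (simp add: dist_norm norm_minus_commute)
qed

lemma triangle_path_unit_speed:
  assumes "{s, t} \<subseteq> {0..1} \<or> {s, t} \<subseteq> {1..2} \<or> {s, t} \<subseteq> {2..3}"
  shows "dist (triangle_path s) (triangle_path t) = \<bar>s - t\<bar>"
proof -
  have e1: "triangle_path r = linepath vertex_O vertex_A r" if "r \<in> {0..1}" for r
    using that by (simp add: triangle_path_def)
  have e2: "triangle_path r = linepath vertex_A vertex_B (r - 1)" if "r \<in> {1..2}" for r
    using that by (auto simp: triangle_path_def linepath_0' linepath_1')
  have e3: "triangle_path r = linepath vertex_B vertex_O (r - 2)" if "r \<in> {2..3}" for r
    using that by (auto simp: triangle_path_def linepath_0' linepath_1')
  from assms show ?thesis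
    by (auto simp: e1 e2 e3 dist_linepath triangle_side_lengths)
qed

lemma triangle_path_image: "triangle_path ` {0..3} = triangle_boundary"
proof -
  have 1: "triangle_path ` {0..1} = closed_segment vertex_O vertex_A"
  proof -
    have "triangle_path ` {0..1} = linepath vertex_O vertex_A ` {0..1}"
      by (intro image_cong) (auto simp: triangle_path_def)
    then show ?thesis by (simp add: linepath_image_01)
  qed
  have 2: "triangle_path ` {1..2} = closed_segment vertex_A vertex_B"
  proof -
    have "triangle_path ` {1..2} = linepath vertex_A vertex_B ` ((\<lambda>t. t - 1) ` {1..2})"
      unfolding image_image
      by (intro image_cong) (auto simp: triangle_path_def linepath_0' linepath_1')
    also have "(\<lambda>t::real. t - 1) ` {1..2} = {0..1}" by simp
    finally show ?thesis by (simp add: linepath_image_01)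
  qed
  have 3: "triangle_path ` {2..3} = closed_segment vertex_B vertex_O"
  proof -
    have "triangle_path ` {2..3} = linepath vertex_B vertex_O ` ((\<lambda>t. t - 2) ` {2..3})"
      unfolding image_image
      by (intro image_cong) (auto simp: triangle_path_def linepath_0' linepath_1')
    also have "(\<lambda>t::real. t - 2) ` {2..3} = {0..1}" by simp
    finally show ?thesis by (simp add: linepath_image_01)
  qed
  have "{0..3::real} = {0..1} \<union> {1..2} \<union> {2..3}" by auto
  then have "triangle_path ` {0..3}
      = triangle_path ` {0..1} \<union> triangle_path ` {1..2} \<union> triangle_path ` {2..3}"
    by (simp only: image_Un)
  then show ?thesis
    by (simp add: 1 2 3 triangle_boundary_def)
qed

lemma triangle_path_measurable [measurable]: "triangle_path \<in> borel_measurable borel"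
  unfolding triangle_path_def linepath_def by measurable

lemma sets_triangle_uniform [simp, measurable_cong]: "sets triangle_uniform = sets borel"
  by (simp add: triangle_uniform_def)

lemma prob_space_triangle_uniform: "prob_space triangle_uniform"
  unfolding triangle_uniform_def
  by (intro prob_space.prob_space_distr prob_space_uniform_measure) simp_all

lemma AE_triangle_uniform: "AE x in triangle_uniform. x \<in> triangle_boundary"
proof -
  have "closed triangle_boundary"
    unfolding triangle_boundary_def by (intro closed_Un closed_segment)
  then have [measurable]: "triangle_boundary \<in> sets borel" by (rule borel_closed)
  have "AE t in uniform_measure lborel {0..3}. triangle_path t \<in> triangle_boundary"
    using triangle_path_image by (intro AE_uniform_measureI AE_I2) auto
  then show ?thesis
    unfolding triangle_uniform_def by (subst AE_distr_iff) simp_all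
qed

lemma integrable_norm_square_triangle_uniform:
  "integrable triangle_uniform (\<lambda>x. (norm x)\<^sup>2)"
proof -
  interpret prob_space triangle_uniform by (rule prob_space_triangle_uniform)
  have "bounded triangle_boundary"
    unfolding triangle_boundary_def by (intro bounded_Un[THEN iffD2] conjI bounded_closed_segment)
  then obtain b where b: "\<And>x. x \<in> triangle_boundary \<Longrightarrow> norm x \<le> b"
    unfolding bounded_iff by blast
  have "AE x in triangle_uniform. norm ((norm x)\<^sup>2) \<le> b\<^sup>2"
    using AE_triangle_uniform by eventually_elim (simp add: b power_mono)
  then show ?thesis
    by (rule integrable_const_bound) simp
qed

end

theory Submission
  imports Defs "HOL-Real_Asymp.Real_Asymp"
begin

text \<open>Everything follows from the asymptotics of \<open>n\<^sup>2 V\<^sub>n\<close>, which explicit bounds on \<open>V\<^sub>n\<close>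
  of matching leading order provide.

  \<^bold>\<open>Upper bound.\<close> For \<open>k = n div 3\<close>, cut every side into \<open>k\<close> equal intervals and take the
  midpoints as codebook. An interval of length \<open>1/k\<close> contributes \<open>1/(12 k\<^sup>3)\<close> to the integral over
  arc length, so the distortion is at most \<open>1/(12 k\<^sup>2)\<close>, which is \<open>3/(4 n\<^sup>2)\<close> to leading order
  (\<open>quantization_error_triangle_uniform_le\<close>).

  \<^bold>\<open>Lower bound.\<close> For every \<open>r > 0\<close> the squared distance to a codebook \<open>\<alpha>\<close> satisfies
  \<open>min\<^sub>c \<parallel>x - c\<parallel>\<^sup>2 \<ge> r\<^sup>2 - (\<Sum>c\<in>\<alpha>. max 0 (r\<^sup>2 - \<parallel>x - c\<parallel>\<^sup>2))\<close>. On a line, each summand is at most a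
  parabolic cap, whose integral is \<open>4 r\<^sup>3 / 3\<close>. If no codebook point served more than one side, the
  distortion would be at least \<open>r\<^sup>2 - 4 n r\<^sup>3 / 9\<close>, which is largest for \<open>r = 3/(2n)\<close>, with value
  \<open>3/(4 n\<^sup>2)\<close>. A codebook point near a corner can serve several sides, but this does no harm after removing
  pieces of length \<open>2r\<close> from both ends of each side: the remaining parts have distance at least \<open>2r\<close>
  from each other, as the sides meet at an angle of 60 degrees, so the open ball of radius
  \<open>r\<close> around a point meets at most one of them (\<open>trimmed_sides_cap\<close>). The removed pieces cost a
  relative error of order \<open>r\<close>, hence a term of order \<open>1/n\<^sup>3\<close> in the bound
  (\<open>distortion_triangle_uniform_ge\<close>).

  The quantization dimension is then a matter of taking logarithms: if \<open>n\<^sup>2 V\<^sub>n\<close> has a positive limit,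
  then \<open>- ln V\<^sub>n\<close> is \<open>2 ln n\<close> up to a bounded term.\<close>


section \<open>Distortion as an integral over arc length\<close>

lemma measurable_Min_norm_square:
  fixes \<alpha> :: "('a::euclidean_space) set"
  assumes "finite \<alpha>"
  shows "(\<lambda>x. MIN c\<in>\<alpha>. (norm (x - c))\<^sup>2) \<in> borel_measurable borel"
  using assms
  by (intro borel_measurable_Min) auto

lemma integral_uniform_measure_Icc:
  fixes f :: "real \<Rightarrow> real"
  assumes "a < b" and [measurable]: "f \<in> borel_measurable borel"
  shows "(\<integral>t. f t \<partial>uniform_measure lborel {a..b}) = (\<integral>t. indicator {a..b} t * f t \<partial>lborel) / (b - a)"
proof -
  have "uniform_measure lborel {a..b} = density lborel (\<lambda>t. ennreal (indicator {a..b} t / (b - a)))"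
    unfolding uniform_measure_def using assms(1)
    by (intro arg_cong[where f = "density lborel"] ext)
       (auto simp: indicator_def divide_ennreal simp flip: ennreal_1)
  then have "(\<integral>t. f t \<partial>uniform_measure lborel {a..b})
      = (\<integral>t. (indicator {a..b} t / (b - a)) *\<^sub>R f t \<partial>lborel)"
    using assms(1) by (simp add: integral_density)
  also have "\<dots> = (\<integral>t. indicator {a..b} t * f t \<partial>lborel) / (b - a)"
    by simp
  finally show ?thesis .
qed

lemma distortion_triangle_uniform:
  assumes "finite \<alpha>"
  shows "distortion triangle_uniform \<alpha>
    = (\<integral>t. indicator {0..3} t * (MIN c\<in>\<alpha>. (norm (triangle_path t - c))\<^sup>2) \<partial>lborel) / 3"
proof -
  have "(\<lambda>t. MIN c\<in>\<alpha>. (norm (triangle_path t - c))\<^sup>2) \<in> borel_measurable borel"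
    by (rule measurable_compose[OF triangle_path_measurable measurable_Min_norm_square[OF assms]])
  then show ?thesis
    unfolding distortion_def triangle_uniform_def
    by (subst integral_distr) (simp_all add: integral_uniform_measure_Icc measurable_Min_norm_square[OF assms])
qed

lemma integrable_Min_norm_square_triangle_path:
  assumes "finite \<alpha>" "\<alpha> \<noteq> {}"
  shows "integrable lborel
    (\<lambda>t. indicator {0..3} t * (MIN c\<in>\<alpha>. (norm (triangle_path t - c))\<^sup>2))"
proof -
  obtain a where a: "a \<in> \<alpha>" using assms by auto
  have "bounded triangle_boundary"
    unfolding triangle_boundary_def by (intro bounded_Un[THEN iffD2] conjI bounded_closed_segment)
  then obtain B where B: "\<And>x. x \<in> triangle_boundary \<Longrightarrow> norm x \<le> B"
    unfolding bounded_iff by blast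
  have *: "norm (MIN c\<in>\<alpha>. (norm (triangle_path t - c))\<^sup>2) \<le> (B + norm a)\<^sup>2" if "t \<in> {0..3}" for t
  proof -
    have "norm (triangle_path t) \<le> B"
      using B triangle_path_image that by blast
    then have "norm (triangle_path t - a) \<le> B + norm a"
      by (smt (verit) norm_triangle_ineq4)
    then have "(norm (triangle_path t - a))\<^sup>2 \<le> (B + norm a)\<^sup>2"
      by (rule power_mono) simp
    moreover have "(MIN c\<in>\<alpha>. (norm (triangle_path t - c))\<^sup>2) \<le> (norm (triangle_path t - a))\<^sup>2"
      using assms a by (intro Min_le) auto
    moreover have "0 \<le> (MIN c\<in>\<alpha>. (norm (triangle_path t - c))\<^sup>2)"
      using assms by (subst Min_ge_iff) auto
    ultimately show ?thesis by simp
  qed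
  have "integrable lborel
    (\<lambda>t. indicator {0..3} t *\<^sub>R (MIN c\<in>\<alpha>. (norm (triangle_path t - c))\<^sup>2))"
  proof (rule integrableI_bounded_set_indicator)
    show "(\<lambda>t. MIN c\<in>\<alpha>. (norm (triangle_path t - c))\<^sup>2) \<in> borel_measurable lborel"
      using measurable_compose[OF triangle_path_measurable measurable_Min_norm_square[OF assms(1)]]
      by simp
    show "AE t in lborel. t \<in> {0..3} \<longrightarrow>
        norm (MIN c\<in>\<alpha>. (norm (triangle_path t - c))\<^sup>2) \<le> (B + norm a)\<^sup>2"
      using * by simp
  qed auto
  then show ?thesis by simp
qed

lemma distortion_triangle_uniform_nonneg:
  assumes "finite \<alpha>" "\<alpha> \<noteq> {}"
  shows "0 \<le> distortion triangle_uniform \<alpha>"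
  using assms unfolding distortion_def
  by (intro integral_nonneg_AE AE_I2) (subst Min_ge_iff, auto)


section \<open>Integrals of parabolas\<close>

lemma has_bochner_integral_cap:
  fixes r \<tau> :: real
  assumes "0 \<le> r"
  shows "has_bochner_integral lborel (\<lambda>t. max 0 (r\<^sup>2 - (t - \<tau>)\<^sup>2)) (4 / 3 * r ^ 3)"
proof -
  have "has_bochner_integral lborel (\<lambda>t. (r\<^sup>2 - (t - \<tau>)\<^sup>2) * indicator {\<tau> - r..\<tau> + r} t)
     ((r\<^sup>2 * (\<tau> + r) - ((\<tau> + r) - \<tau>) ^ 3 / 3) - (r\<^sup>2 * (\<tau> - r) - ((\<tau> - r) - \<tau>) ^ 3 / 3))"
    using assms
    by (intro has_bochner_integral_FTC_Icc_real)
       (auto intro!: derivative_eq_intros continuous_intros simp: power2_eq_square)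
  also have "(\<lambda>t. (r\<^sup>2 - (t - \<tau>)\<^sup>2) * indicator {\<tau> - r..\<tau> + r} t) = (\<lambda>t. max 0 (r\<^sup>2 - (t - \<tau>)\<^sup>2))"
  proof
    fix t
    have "(t - \<tau>)\<^sup>2 \<le> r\<^sup>2 \<longleftrightarrow> t \<in> {\<tau> - r..\<tau> + r}"
      using assms abs_le_square_iff[of "t - \<tau>" r] by auto
    then show "(r\<^sup>2 - (t - \<tau>)\<^sup>2) * indicator {\<tau> - r..\<tau> + r} t = max 0 (r\<^sup>2 - (t - \<tau>)\<^sup>2)"
      by (auto simp: indicator_def max_def)
  qed
  also have "(r\<^sup>2 * (\<tau> + r) - ((\<tau> + r) - \<tau>) ^ 3 / 3) - (r\<^sup>2 * (\<tau> - r) - ((\<tau> - r) - \<tau>) ^ 3 / 3)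
      = 4 / 3 * r ^ 3"
    by (simp add: field_simps power2_eq_square power3_eq_cube)
  finally show ?thesis .
qed

lemma has_bochner_integral_cell:
  fixes m h :: real
  assumes "0 \<le> h"
  shows "has_bochner_integral lborel (\<lambda>t. (t - m)\<^sup>2 * indicator {m - h..m + h} t) (2 / 3 * h ^ 3)"
proof -
  have "has_bochner_integral lborel (\<lambda>t. (t - m)\<^sup>2 * indicator {m - h..m + h} t)
     (((m + h) - m) ^ 3 / 3 - ((m - h) - m) ^ 3 / 3)"
    using assms
    by (intro has_bochner_integral_FTC_Icc_real)
       (auto intro!: derivative_eq_intros continuous_intros simp: power2_eq_square)
  then show ?thesis by simp
qed


section \<open>Geometry of the trimmed sides\<close>

text \<open>By the law of cosines the squared distance is \<open>s\<^sup>2 + t\<^sup>2 - s t = (s - t)\<^sup>2 + s t\<close>, which is at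
  least \<open>\<epsilon>\<^sup>2\<close>.\<close>

lemma ray_distance_60:
  fixes s t \<epsilon> :: real and u v :: "'a::real_inner"
  assumes "norm u = 1" "norm v = 1" "u \<bullet> v = 1 / 2" "\<epsilon> \<le> s" "\<epsilon> \<le> t" "0 \<le> \<epsilon>"
  shows "\<epsilon> \<le> dist (a + s *\<^sub>R u) (a + t *\<^sub>R v)"
proof -
  have "u \<bullet> u = 1" "v \<bullet> v = 1" using assms by (simp_all add: dot_square_norm)
  then have "(dist (a + s *\<^sub>R u) (a + t *\<^sub>R v))\<^sup>2 = s * s + t * t - s * t"
    using assms(3)
    by (simp add: dist_norm power2_norm_eq_inner inner_diff inner_commute algebra_simps)
  also have "\<dots> = (s - t)\<^sup>2 + s * t" by (simp add: power2_eq_square algebra_simps)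
  also have "\<dots> \<ge> \<epsilon>\<^sup>2"
    using mult_mono[of \<epsilon> s \<epsilon> t] assms by (smt (verit) power2_eq_square zero_le_power2)
  finally show ?thesis by (rule power2_le_imp_le) simp
qed

text \<open>These are arc-length parameters: what is left of the three unit sides when both ends of each are
  shortened by \<open>\<epsilon>\<close>.\<close>

definition trimmed_sides :: "real \<Rightarrow> real set" where
  "trimmed_sides \<epsilon> = {\<epsilon>..1 - \<epsilon>} \<union> {1 + \<epsilon>..2 - \<epsilon>} \<union> {2 + \<epsilon>..3 - \<epsilon>}"

lemma triangle_path_sides:
  "t \<in> {0..1} \<Longrightarrow> triangle_path t = vertex_O + t *\<^sub>R (vertex_A - vertex_O)"
  "t \<in> {1..2} \<Longrightarrow> triangle_path t = vertex_A + (t - 1) *\<^sub>R (vertex_B - vertex_A)"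
  "t \<in> {2..3} \<Longrightarrow> triangle_path t = vertex_B + (t - 2) *\<^sub>R (vertex_O - vertex_B)"
  by (auto simp: triangle_path_def linepath_def vec_eq_iff algebra_simps)

lemma triangle_sides_inner:
  "(vertex_A - vertex_O) \<bullet> (vertex_B - vertex_O) = 1 / 2"
  "(vertex_B - vertex_A) \<bullet> (vertex_O - vertex_A) = 1 / 2"
  "(vertex_O - vertex_B) \<bullet> (vertex_A - vertex_B) = 1 / 2"
  by (simp_all add: inner_vec_def sum_2 vertex_O_def vertex_A_def vertex_B_def algebra_simps)

lemma triangle_sides_norm:
  "norm (vertex_A - vertex_O) = 1" "norm (vertex_B - vertex_O) = 1"
  "norm (vertex_B - vertex_A) = 1" "norm (vertex_O - vertex_A) = 1"
  "norm (vertex_O - vertex_B) = 1" "norm (vertex_A - vertex_B) = 1"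
  using triangle_side_lengths by (simp_all add: dist_norm norm_minus_commute)

text \<open>Any two sides share a vertex. Measured from that vertex, points on the trimmed sides are at
  distance at least \<open>\<epsilon>\<close> along two rays at 60 degrees, so \<open>ray_distance_60\<close> applies.\<close>

lemma trimmed_sides_separated:
  assumes "0 \<le> \<epsilon>" "s \<in> {i + \<epsilon>..i + 1 - \<epsilon>}" "t \<in> {j + \<epsilon>..j + 1 - \<epsilon>}"
    and "i \<in> {0, 1, 2}" "j \<in> {0, 1, 2}" "i \<noteq> j"
  shows "\<epsilon> \<le> dist (triangle_path s) (triangle_path t)"
proof -
  (* By symmetry of the distance it suffices to treat the three pairs with i < j. *)
  have w: "\<epsilon> \<le> dist (triangle_path s) (triangle_path t)"
    if "s \<in> {i + \<epsilon>..i + 1 - \<epsilon>}" "t \<in> {j + \<epsilon>..j + 1 - \<epsilon>}" "(i, j) \<in> {(0, 1), (1, 2), (0, 2)}"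
    for s t i j :: real
  proof -
    consider "i = 0" "j = 1" | "i = 1" "j = 2" | "i = 0" "j = 2" using \<open>(i, j) \<in> _\<close> by auto
    then show ?thesis
    proof cases
      case 1
      have "triangle_path s = vertex_A + (1 - s) *\<^sub>R (vertex_O - vertex_A)"
        using that assms(1) 1 by (subst triangle_path_sides(1)) (auto simp: vec_eq_iff algebra_simps)
      moreover have "triangle_path t = vertex_A + (t - 1) *\<^sub>R (vertex_B - vertex_A)"
        using that assms(1) 1 by (subst triangle_path_sides(2)) auto
      ultimately show ?thesis
        using that assms(1) 1 triangle_sides_inner triangle_sides_norm
        by (simp only:) (rule ray_distance_60, auto simp: inner_commute)
    next
      case 2
      have "triangle_path s = vertex_B + (2 - s) *\<^sub>R (vertex_A - vertex_B)"
        using that assms(1) 2 by (subst triangle_path_sides(2)) (auto simp: vec_eq_iff algebra_simps)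
      moreover have "triangle_path t = vertex_B + (t - 2) *\<^sub>R (vertex_O - vertex_B)"
        using that assms(1) 2 by (subst triangle_path_sides(3)) auto
      ultimately show ?thesis
        using that assms(1) 2 triangle_sides_inner triangle_sides_norm
        by (simp only:) (rule ray_distance_60, auto simp: inner_commute)
    next
      case 3
      have "triangle_path s = vertex_O + s *\<^sub>R (vertex_A - vertex_O)"
        using that assms(1) 3 by (subst triangle_path_sides(1)) auto
      moreover have "triangle_path t = vertex_O + (3 - t) *\<^sub>R (vertex_B - vertex_O)"
        using that assms(1) 3 by (subst triangle_path_sides(3)) (auto simp: vec_eq_iff algebra_simps)
      ultimately show ?thesis
        using that assms(1) 3 triangle_sides_inner triangle_sides_norm
        by (simp only:) (rule ray_distance_60, auto simp: inner_commute)
    qed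
  qed
  show ?thesis
    using assms(2-) w[of s i t j] w[of t j s i] by (auto simp: dist_commute)
qed

lemma unit_line_projection:
  fixes u :: "'a::real_inner"
  assumes "norm u = 1"
  shows "\<bar>t - (c - a) \<bullet> u\<bar> \<le> norm (a + t *\<^sub>R u - c)"
proof -
  have "u \<bullet> u = 1" using assms by (simp add: dot_square_norm)
  then have "t - (c - a) \<bullet> u = (a + t *\<^sub>R u - c) \<bullet> u"
    by (simp add: inner_diff_left inner_add_left)
  then show ?thesis
    using Cauchy_Schwarz_ineq2[of "a + t *\<^sub>R u - c" u] assms by simp
qed

text \<open>The parameter of the orthogonal projection of \<open>c\<close> onto the line through the side serves as \<open>\<tau>\<close>.\<close>

lemma triangle_side_projection:
  assumes "i \<in> {0, 1, 2}"
  shows "\<exists>\<tau>. \<forall>t\<in>{i..i + 1}. \<bar>t - \<tau>\<bar> \<le> norm (triangle_path t - c)"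
proof -
  have "\<exists>a u. norm u = 1 \<and> (\<forall>t\<in>{i..i + 1}. triangle_path t = a + (t - i) *\<^sub>R u)"
    using assms triangle_path_sides triangle_sides_norm by fastforce
  then obtain a u where u: "norm u = 1" "\<And>t. t \<in> {i..i + 1} \<Longrightarrow> triangle_path t = a + (t - i) *\<^sub>R u"
    by blast
  have "\<bar>t - (i + (c - a) \<bullet> u)\<bar> \<le> norm (triangle_path t - c)" if "t \<in> {i..i + 1}" for t
    using unit_line_projection[OF u(1), of "t - i" c a] by (simp add: u(2)[OF that] diff_diff_eq)
  then show ?thesis by blast
qed

text \<open>The left-hand side vanishes outside the open ball of radius \<open>r\<close> around \<open>c\<close>. That ball meets at most
  one of the trimmed sides, because these are \<open>2r\<close> apart, and on this side projecting
  \<open>c\<close> onto the line only shortens distances. So a single one-dimensional cap dominates on all three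
  sides at once.\<close>

lemma trimmed_sides_cap:
  assumes "0 < r"
  shows "\<exists>\<tau>. \<forall>t\<in>trimmed_sides (2 * r).
    max 0 (r\<^sup>2 - (norm (triangle_path t - c))\<^sup>2) \<le> max 0 (r\<^sup>2 - (t - \<tau>)\<^sup>2)"
proof (cases "\<exists>s\<in>trimmed_sides (2 * r). norm (triangle_path s - c) < r")
  case False
  then have "max 0 (r\<^sup>2 - (norm (triangle_path t - c))\<^sup>2) = 0" if "t \<in> trimmed_sides (2 * r)" for t
    using that assms by (smt (verit) power_mono)
  then show ?thesis by auto
next
  case True
  have pieces: "\<exists>i\<in>{0, 1, 2}. t \<in> {i + 2 * r..i + 1 - 2 * r}" if "t \<in> trimmed_sides (2 * r)" for t
    using that by (auto simp: trimmed_sides_def)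
  obtain s i where s: "norm (triangle_path s - c) < r" "i \<in> {0, 1, 2}" "s \<in> {i + 2 * r..i + 1 - 2 * r}"
    using True pieces by blast
  obtain \<tau> where \<tau>: "\<And>t. t \<in> {i..i + 1} \<Longrightarrow> \<bar>t - \<tau>\<bar> \<le> norm (triangle_path t - c)"
    using triangle_side_projection[OF s(2), of c] by blast
  show ?thesis
  proof (intro exI ballI)
    fix t assume "t \<in> trimmed_sides (2 * r)"
    then obtain j where j: "j \<in> {0, 1, 2}" "t \<in> {j + 2 * r..j + 1 - 2 * r}"
      using pieces by blast
    show "max 0 (r\<^sup>2 - (norm (triangle_path t - c))\<^sup>2) \<le> max 0 (r\<^sup>2 - (t - \<tau>)\<^sup>2)"
    proof (cases "i = j")
      case True
      then have "\<bar>t - \<tau>\<bar> \<le> norm (triangle_path t - c)" using \<tau> j assms by auto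
      then have "(t - \<tau>)\<^sup>2 \<le> (norm (triangle_path t - c))\<^sup>2"
        using power_mono[of "\<bar>t - \<tau>\<bar>" _ 2] by simp
      then show ?thesis by simp
    next
      case False
      have "2 * r \<le> dist (triangle_path s) (triangle_path t)"
        using assms s j False by (intro trimmed_sides_separated[of _ s i t j]) auto
      then have "r \<le> norm (triangle_path t - c)"
        using s(1) dist_triangle2[of "triangle_path s" "triangle_path t" c] by (simp add: dist_norm)
      then have "r\<^sup>2 \<le> (norm (triangle_path t - c))\<^sup>2" using assms by (intro power_mono) auto
      then show ?thesis by simp
    qed
  qed
qed

lemma has_bochner_integral_indicator_trimmed_sides:
  assumes "0 < \<epsilon>" "2 * \<epsilon> \<le> 1"
  shows "has_bochner_integral lborel (indicator (trimmed_sides \<epsilon>)) (3 * (1 - 2 * \<epsilon>))"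
proof -
  have Icc: "has_bochner_integral lborel (indicator {a..b} :: real \<Rightarrow> real) (b - a)" if "a \<le> b" for a b
    using has_bochner_integral_real_indicator[of "{a..b}" lborel] that by simp
  have "has_bochner_integral lborel (\<lambda>t. indicator {\<epsilon>..1 - \<epsilon>} t + indicator {1 + \<epsilon>..2 - \<epsilon>} t
      + indicator {2 + \<epsilon>..3 - \<epsilon>} t :: real)
      ((1 - \<epsilon> - \<epsilon>) + (2 - \<epsilon> - (1 + \<epsilon>)) + (3 - \<epsilon> - (2 + \<epsilon>)))"
    using assms
    by (intro has_bochner_integral_add Icc) auto
  moreover have "(\<lambda>t. indicator {\<epsilon>..1 - \<epsilon>} t + indicator {1 + \<epsilon>..2 - \<epsilon>} t
      + indicator {2 + \<epsilon>..3 - \<epsilon>} t :: real) = indicator (trimmed_sides \<epsilon>)"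
    using assms by (auto simp: trimmed_sides_def indicator_def fun_eq_iff)
  ultimately show ?thesis by (simp add: algebra_simps)
qed


section \<open>Lower bound for the quantization error\<close>

text \<open>At a minimizer \<open>c\<close> of \<open>f\<close>, already the summand belonging to \<open>c\<close> is at least \<open>b - f c\<close>.\<close>

lemma Min_ge_minus_sum_excess:
  fixes f :: "'b \<Rightarrow> real"
  assumes "finite A" "A \<noteq> {}"
  shows "b - (\<Sum>c\<in>A. max 0 (b - f c)) \<le> (MIN c\<in>A. f c)"
proof -
  have "(MIN c\<in>A. f c) \<in> f ` A" using assms by (intro Min_in) auto
  then obtain c where c: "c \<in> A" "(MIN c\<in>A. f c) = f c" by blast
  have "max 0 (b - f c) \<le> (\<Sum>c\<in>A. max 0 (b - f c))"
    using assms c by (intro member_le_sum) auto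
  then show ?thesis using c by linarith
qed

text \<open>Integrate \<open>Min_ge_minus_sum_excess\<close> for \<open>b = r\<^sup>2\<close> over the trimmed sides, of total length
  \<open>3 (1 - 4r)\<close>, with every summand dominated as in \<open>trimmed_sides_cap\<close>. This bounds the distortion
  below by \<open>r\<^sup>2 (1 - 4r) - 4 n r\<^sup>3 / 9\<close>.\<close>

lemma distortion_triangle_uniform_ge:
  assumes "finite \<alpha>" "\<alpha> \<noteq> {}" "card \<alpha> \<le> n" "6 \<le> n"
  shows "(3 / 4 - 27 / (2 * real n)) / (real n)\<^sup>2 \<le> distortion triangle_uniform \<alpha>"
proof -
  (* This maximizes r^2 - 4 n r^3 / 9, the bound without the trimming loss. For n >= 6 the trimmed
     sides are nonempty. *)
  define r where "r = 3 / (2 * real n)"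
  have r: "0 < r" "4 * r \<le> 1" using assms(4) by (auto simp: r_def field_simps)
  define T where "T = trimmed_sides (2 * r)"
  obtain \<tau> where \<tau>: "\<And>c t. t \<in> T \<Longrightarrow>
      max 0 (r\<^sup>2 - (norm (triangle_path t - c))\<^sup>2) \<le> max 0 (r\<^sup>2 - (t - \<tau> c)\<^sup>2)"
    using trimmed_sides_cap[OF r(1)] unfolding T_def by metis
  let ?d = "\<lambda>t. MIN c\<in>\<alpha>. (norm (triangle_path t - c))\<^sup>2"
  let ?g = "\<lambda>t. r\<^sup>2 * indicator T t - (\<Sum>c\<in>\<alpha>. max 0 (r\<^sup>2 - (t - \<tau> c)\<^sup>2))"
  have g: "has_bochner_integral lborel ?g
      (r\<^sup>2 * (3 * (1 - 2 * (2 * r))) - (\<Sum>c\<in>\<alpha>. 4 / 3 * r ^ 3))"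
    unfolding T_def using r
    by (intro has_bochner_integral_diff has_bochner_integral_mult_right has_bochner_integral_sum
        has_bochner_integral_indicator_trimmed_sides has_bochner_integral_cap) auto
  have le: "?g t \<le> indicator {0..3} t * ?d t" for t
  proof (cases "t \<in> T")
    case True
    then have "t \<in> {0..3}" using r by (auto simp: T_def trimmed_sides_def)
    have "?g t \<le> r\<^sup>2 - (\<Sum>c\<in>\<alpha>. max 0 (r\<^sup>2 - (norm (triangle_path t - c))\<^sup>2))"
      using True \<tau>[OF True] by (auto intro!: sum_mono)
    also have "\<dots> \<le> ?d t"
      using assms by (intro Min_ge_minus_sum_excess)
    finally show ?thesis using \<open>t \<in> {0..3}\<close> by simp
  next
    case False
    have "0 \<le> ?d t" using assms by (subst Min_ge_iff) auto
    moreover have "0 \<le> (\<Sum>c\<in>\<alpha>. max 0 (r\<^sup>2 - (t - \<tau> c)\<^sup>2))" by (intro sum_nonneg) auto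
    ultimately show ?thesis using False by (auto simp: indicator_def)
  qed
  have "3 * r\<^sup>2 * (1 - 4 * r) - real n * (4 / 3 * r ^ 3)
      \<le> r\<^sup>2 * (3 * (1 - 2 * (2 * r))) - (\<Sum>c\<in>\<alpha>. 4 / 3 * r ^ 3)"
  proof -
    have "real (card \<alpha>) * (4 / 3 * r ^ 3) \<le> real n * (4 / 3 * r ^ 3)"
      using assms(3) r by (intro mult_right_mono) auto
    then show ?thesis by (simp add: algebra_simps)
  qed
  also have "\<dots> = integral\<^sup>L lborel ?g"
    using g by (simp add: has_bochner_integral_iff)
  also have "\<dots> \<le> (\<integral>t. indicator {0..3} t * ?d t \<partial>lborel)"
    using g integrable_Min_norm_square_triangle_path[OF assms(1,2)] le
    by (intro integral_mono) (auto simp: has_bochner_integral_iff)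
  also have "\<dots> = 3 * distortion triangle_uniform \<alpha>"
    using assms(1) by (simp add: distortion_triangle_uniform)
  finally have "r\<^sup>2 * (1 - 4 * r) - real n * (4 / 9 * r ^ 3) \<le> distortion triangle_uniform \<alpha>"
    by (simp add: algebra_simps)
  moreover have "r\<^sup>2 * (1 - 4 * r) - real n * (4 / 9 * r ^ 3) = (3 / 4 - 27 / (2 * real n)) / (real n)\<^sup>2"
    using assms(4) by (simp add: r_def field_simps power2_eq_square power3_eq_cube)
  ultimately show ?thesis by simp
qed

lemma quantization_error_triangle_uniform_ge:
  assumes "6 \<le> n"
  shows "(3 / 4 - 27 / (2 * real n)) / (real n)\<^sup>2 \<le> quantization_error triangle_uniform n"
  unfolding quantization_error_def
proof (rule cINF_greatest)
  show "{\<alpha>::(real^2) set. finite \<alpha> \<and> 1 \<le> card \<alpha> \<and> card \<alpha> \<le> n} \<noteq> {}"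
    using assms by (auto intro!: exI[of _ "{0}"])
  show "(3 / 4 - 27 / (2 * real n)) / (real n)\<^sup>2 \<le> distortion triangle_uniform \<alpha>"
    if "\<alpha> \<in> {\<alpha>. finite \<alpha> \<and> 1 \<le> card \<alpha> \<and> card \<alpha> \<le> n}" for \<alpha>
    using that assms by (intro distortion_triangle_uniform_ge) auto
qed


section \<open>Upper bound for the quantization error\<close>

lemma Icc_cell_cover:
  fixes k N :: nat and t :: real
  assumes "0 < k" "0 < N" "0 \<le> t" "t \<le> real N / real k"
  shows "\<exists>j<N. real j / real k \<le> t \<and> t \<le> (real j + 1) / real k"
proof (cases "t = real N / real k")
  case True
  then show ?thesis
    using assms by (intro exI[of _ "N - 1"]) (auto simp: of_nat_diff field_simps)
next
  case False
  then have "real k * t < real N" using assms by (simp add: field_simps)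
  moreover have "0 \<le> real k * t" using assms by simp
  ultimately show ?thesis
    using assms of_nat_floor[of "real k * t"] floor_correct[of "real k * t"]
    by (intro exI[of _ "nat \<lfloor>real k * t\<rfloor>"]) (auto simp: field_simps nat_less_iff floor_less_iff)
qed

text \<open>The codebook consists of the midpoints of the \<open>3k\<close> arcs \<open>[j/k, (j+1)/k]\<close>. As the vertices sit at
  integer parameters, no arc contains a vertex in its interior, and the distance from a point of the
  arc to the midpoint is the difference of the parameters.\<close>

lemma ex_distortion_triangle_uniform_le:
  assumes "0 < k"
  shows "\<exists>\<alpha>. finite \<alpha> \<and> 1 \<le> card \<alpha> \<and> card \<alpha> \<le> 3 * k
    \<and> distortion triangle_uniform \<alpha> \<le> 1 / (12 * (real k)\<^sup>2)"
proof -
  define m where "m j = (real j + 1 / 2) / real k" for j :: nat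
  define h where "h = 1 / (2 * real k)"
  have cell: "m j - h = real j / real k" "m j + h = (real j + 1) / real k" for j
    using assms by (simp_all add: m_def h_def field_simps)
  define \<alpha> where "\<alpha> = (\<lambda>j. triangle_path (m j)) ` {..<3 * k}"
  have \<alpha>: "finite \<alpha>" "\<alpha> \<noteq> {}" "card \<alpha> \<le> 3 * k"
    using assms card_image_le[of "{..<3 * k}" "\<lambda>j. triangle_path (m j)"]
    by (auto simp: \<alpha>_def lessThan_empty_iff)
  let ?d = "\<lambda>t. MIN c\<in>\<alpha>. (norm (triangle_path t - c))\<^sup>2"
  let ?g = "\<lambda>t. \<Sum>j<3 * k. (t - m j)\<^sup>2 * indicator {m j - h..m j + h} t"
  have g: "has_bochner_integral lborel ?g (\<Sum>j<3 * k. 2 / 3 * h ^ 3)"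
    by (intro has_bochner_integral_sum has_bochner_integral_cell) (simp add: h_def)
  have le: "indicator {0..3} t * ?d t \<le> ?g t" for t
  proof (cases "t \<in> {0..3}")
    case True
    then obtain j where j: "j < 3 * k" "t \<in> {m j - h..m j + h}"
      using Icc_cell_cover[of k "3 * k" t] assms by (auto simp: cell)
    have "{t, m j} \<subseteq> {0..1} \<or> {t, m j} \<subseteq> {1..2} \<or> {t, m j} \<subseteq> {2..3}"
    proof -
      have "h \<ge> 0" by (simp add: h_def)
      have sub: "{t, m j} \<subseteq> {a..b}" if "a \<le> m j - h" "m j + h \<le> b" for a b
        using that j \<open>h \<ge> 0\<close> by auto
      consider "j < k" | "k \<le> j" "j < 2 * k" | "2 * k \<le> j" by linarith
      then show ?thesis
      proof cases
        case 1
        then have "{t, m j} \<subseteq> {0..1}" using assms by (intro sub; simp add: cell; simp add: field_simps)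
        then show ?thesis by simp
      next
        case 2
        then have "{t, m j} \<subseteq> {1..2}" using assms by (intro sub; simp add: cell; simp add: field_simps)
        then show ?thesis by simp
      next
        case 3
        then have "{t, m j} \<subseteq> {2..3}" using assms j by (intro sub; simp add: cell; simp add: field_simps)
        then show ?thesis by simp
      qed
    qed
    then have "norm (triangle_path t - triangle_path (m j)) = \<bar>t - m j\<bar>"
      using triangle_path_unit_speed by (simp add: dist_norm)
    then have "?d t \<le> (t - m j)\<^sup>2"
      using \<alpha> j by (intro Min.coboundedI) (auto simp: \<alpha>_def image_iff intro!: bexI[of _ j])
    also have "\<dots> = (t - m j)\<^sup>2 * indicator {m j - h..m j + h} t" using j by simp
    also have "\<dots> \<le> ?g t"
      using j by (intro member_le_sum) auto
    finally show ?thesis using True by simp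
  next
    case False
    then show ?thesis by (auto intro!: sum_nonneg)
  qed
  have "3 * distortion triangle_uniform \<alpha> = (\<integral>t. indicator {0..3} t * ?d t \<partial>lborel)"
    using \<alpha> by (simp add: distortion_triangle_uniform)
  also have "\<dots> \<le> integral\<^sup>L lborel ?g"
    using g integrable_Min_norm_square_triangle_path[OF \<alpha>(1,2)] le
    by (intro integral_mono) (auto simp: has_bochner_integral_iff)
  also have "\<dots> = (\<Sum>j<3 * k. 2 / 3 * h ^ 3)"
    using g by (simp add: has_bochner_integral_iff)
  also have "\<dots> = 3 * (1 / (12 * (real k)\<^sup>2))"
    using assms by (simp add: h_def field_simps power2_eq_square power3_eq_cube)
  finally show ?thesis
    using \<alpha> by (intro exI[of _ \<alpha>]) (auto simp: Suc_le_eq card_gt_0_iff)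
qed

text \<open>Here \<open>n - 2\<close> appears since \<open>3 (n div 3)\<close> can fall short of \<open>n\<close> by up to two.\<close>

lemma quantization_error_triangle_uniform_le:
  assumes "3 \<le> n"
  shows "quantization_error triangle_uniform n \<le> 3 / (4 * (real n - 2)\<^sup>2)"
proof -
  define k where "k = n div 3"
  have k: "0 < k" "3 * k \<le> n" "n \<le> 3 * k + 2" using assms unfolding k_def by auto
  obtain \<alpha> where \<alpha>: "finite \<alpha>" "1 \<le> card \<alpha>" "card \<alpha> \<le> 3 * k"
      "distortion triangle_uniform \<alpha> \<le> 1 / (12 * (real k)\<^sup>2)"
    using ex_distortion_triangle_uniform_le[OF k(1)] by blast
  have "quantization_error triangle_uniform n \<le> distortion triangle_uniform \<alpha>"
    unfolding quantization_error_def
  proof (rule cINF_lower)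
    show "bdd_below (distortion triangle_uniform ` {\<alpha>. finite \<alpha> \<and> 1 \<le> card \<alpha> \<and> card \<alpha> \<le> n})"
      by (intro bdd_belowI2[of _ 0] distortion_triangle_uniform_nonneg) auto
    show "\<alpha> \<in> {\<alpha>. finite \<alpha> \<and> 1 \<le> card \<alpha> \<and> card \<alpha> \<le> n}" using \<alpha> k by auto
  qed
  also note \<alpha>(4)
  also have "1 / (12 * (real k)\<^sup>2) = 3 / (4 * (3 * real k)\<^sup>2)"
    by (simp add: power_mult_distrib)
  also have "\<dots> \<le> 3 / (4 * (real n - 2)\<^sup>2)"
    using k assms by (intro divide_left_mono mult_left_mono power_mono mult_pos_pos) auto
  finally show ?thesis .
qed


section \<open>Quantization coefficient and quantization dimension\<close>

lemma square_times_quantization_error_triangle_uniform_tendsto: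
  "(\<lambda>n. (real n)\<^sup>2 * quantization_error triangle_uniform n) \<longlonglongrightarrow> 3 / 4"
proof (rule tendsto_sandwich)
  show "\<forall>\<^sub>F n in sequentially. 3 / 4 - 27 / (2 * real n)
      \<le> (real n)\<^sup>2 * quantization_error triangle_uniform n"
    using eventually_ge_at_top[of 6]
  proof eventually_elim
    case (elim n)
    then show ?case
      using quantization_error_triangle_uniform_ge[of n] by (simp add: field_simps)
  qed
  show "\<forall>\<^sub>F n in sequentially. (real n)\<^sup>2 * quantization_error triangle_uniform n
      \<le> (real n)\<^sup>2 * (3 / (4 * (real n - 2)\<^sup>2))"
    using eventually_ge_at_top[of 3]
    by eventually_elim (intro mult_left_mono quantization_error_triangle_uniform_le, auto)
  show "(\<lambda>n. 3 / 4 - 27 / (2 * real n)) \<longlonglongrightarrow> 3 / 4" by real_asymp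
  show "(\<lambda>n. (real n)\<^sup>2 * (3 / (4 * (real n - 2)\<^sup>2))) \<longlonglongrightarrow> 3 / 4" by real_asymp
qed

text \<open>Dividing \<open>- ln V\<^sub>n = 2 ln n - ln (n\<^sup>2 V\<^sub>n)\<close> by \<open>ln n\<close> gives a quotient that tends to \<open>2\<close>, because
  \<open>ln (n\<^sup>2 V\<^sub>n)\<close> converges.\<close>

lemma quantization_dimension_of_coefficient:
  fixes V :: "nat \<Rightarrow> real"
  assumes "0 < C" and lim: "(\<lambda>n. (real n)\<^sup>2 * V n) \<longlonglongrightarrow> C"
  shows "(\<lambda>n. 2 * ln (real n) / - ln (V n)) \<longlonglongrightarrow> 1"
proof -
  have "(\<lambda>n. ln ((real n)\<^sup>2 * V n) * inverse (ln (real n))) \<longlonglongrightarrow> ln C * 0"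
    using assms(1) by (intro tendsto_mult tendsto_ln lim) (auto, real_asymp)
  then have "(\<lambda>n. 2 / (2 - ln ((real n)\<^sup>2 * V n) * inverse (ln (real n)))) \<longlonglongrightarrow> 2 / (2 - ln C * 0)"
    by (rule tendsto_divide[OF tendsto_const tendsto_diff[OF tendsto_const]]) simp
  then have "(\<lambda>n. 2 / (2 - ln ((real n)\<^sup>2 * V n) * inverse (ln (real n)))) \<longlonglongrightarrow> 1" by simp
  moreover have "\<forall>\<^sub>F n in sequentially.
      2 / (2 - ln ((real n)\<^sup>2 * V n) * inverse (ln (real n))) = 2 * ln (real n) / - ln (V n)"
    using order_tendstoD(1)[OF lim assms(1)] eventually_ge_at_top[of 2]
  proof eventually_elim
    case (elim n)
    have "0 < ln (real n)" using elim by simp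
    have "0 < V n" using elim(1) by (simp add: zero_less_mult_iff)
    then have "ln ((real n)\<^sup>2 * V n) = 2 * ln (real n) + ln (V n)"
      using elim by (simp add: ln_mult ln_realpow)
    then have "2 - ln ((real n)\<^sup>2 * V n) * inverse (ln (real n)) = - ln (V n) / ln (real n)"
      using \<open>0 < ln (real n)\<close> by (simp add: field_simps)
    then show ?case by simp
  qed
  ultimately show ?thesis by (rule Lim_transform_eventually)
qed

theorem proposition2p3p12:
  shows "has_quantization_dimension triangle_uniform 1
    \<and> (\<lambda>n. 2 * ln (real n) / - ln (quantization_error triangle_uniform n)) \<longlonglongrightarrow> 1
    \<and> has_quantization_coefficient 1 triangle_uniform (ereal (3 / 4))
    \<and> (\<lambda>n. (real n)\<^sup>2 * quantization_error triangle_uniform n) \<longlonglongrightarrow> 3 / 4"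
proof -
  note coeff = square_times_quantization_error_triangle_uniform_tendsto
  have dim: "(\<lambda>n. 2 * ln (real n) / - ln (quantization_error triangle_uniform n)) \<longlonglongrightarrow> 1"
    by (rule quantization_dimension_of_coefficient[OF _ coeff]) simp
  have "has_quantization_dimension triangle_uniform 1"
    unfolding has_quantization_dimension_def lower_quantization_dimension_def
      upper_quantization_dimension_def one_ereal_def
    by (intro conjI lim_imp_Liminf lim_imp_Limsup tendsto_ereal dim) simp_all
  moreover have "has_quantization_coefficient 1 triangle_uniform (ereal (3 / 4))"
    unfolding has_quantization_coefficient_def lower_quantization_coefficient_def
      upper_quantization_coefficient_def
    using coeff
    by (intro conjI lim_imp_Liminf lim_imp_Limsup tendsto_ereal) simp_all
  ultimately show ?thesis using dim coeff by blast
qed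

end
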